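(* Let $\pi_1:(P_1,\Sigma_1)\to(Q,\Sigma)$ and $\pi_2:(P_2,\Sigma_2)\to(Q,\Sigma)$ be morphisms in the category $\mathcal{P}$, where $(P_1,\Sigma_1)$ and $(P_2,\Sigma_2)$ are flag and $(Q,\Sigma)$ has unique standard monomials. If each $(P_i,\Sigma_i)$ is normal, then the fiber product $(P_1,\Sigma_1)\times_{(Q,\Sigma)}(P_2,\Sigma_2)$ is normal.
   Context: For a lattice polytope $P\subset\mathbb{R}^n$, $X_P$ is its set of lattice points, $\mathbb{C}[X_P]$ is the polynomial ring with one variable per lattice point, $mP$ is the $m$-fold Minkowski sum, and $\mathbb{C}[P]$ is the graded algebra whose $m$-th graded component has as basis the lattice points of $mP$, with product given by addition. $I_P$ is the kernel of $\mathbb{C}[X_P]\to\mathbb{C}[P]$. $P$ (or $(P,\Sigma)$) is normal if $\mathbb{C}[P]$ is generated in degree $1$, by the elements corresponding to the lattice points of $P$. A term order on $P$ is a function $\Sigma:X_P\to\mathbb{R}$. For a monomial $x^{\mathbf m}=x_1^{m_1}\cdots x_k^{m_k}$ put $\Sigma(\mathbf m)=\sum_i m_i\Sigma(x_i)$; monomials are (partially) ordered first by degree and then by the value of $\Sigma$. A monomial is standard if it is not the initial form (sum of largest terms) of any polynomial in $I_P$. Equivalently, for a lattice point $b\in mP$ let $\Delta_b$ be the set of degree $m$ monomials of $\mathbb{C}[X_P]$ mapping to $b$; the standard monomials in $\Delta_b$ are those with minimal $\Sigma$-value. $(P,\Sigma)$ has unique standard monomials if each non-empty $\Delta_b$ has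 a unique minimal element. $(P,\Sigma)$ is flag if a monomial is standard if and only if each of its degree $2$ divisors is standard, and $x^n$ is standard for every $x\in X_P$ and every $n$. The category $\mathcal{P}$ has as objects pairs $(P,\Sigma)$ of a lattice polytope and a term order on it; a morphism $\pi:(P,\Sigma)\to(Q,\Gamma)$ is a linear map $P\to Q$, induced by a map on lattices, taking standard monomials of $\Sigma$ to standard monomials of $\Gamma$. Under the hypothesis on $(Q,\Sigma)$, the fiber product $(P_1,\Sigma_1)\times_{(Q,\Sigma)}(P_2,\Sigma_2)$ in $\mathcal{P}$ is the polytope $P_1\times_QP_2=\{(x,y)\in P_1\times P_2:\pi_1(x)=\pi_2(y)\}$ with term order $(\Sigma_1\oplus\Sigma_2)(u,v)=\Sigma_1(u)+\Sigma_2(v)$. *)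

theory Defs
  imports "HOL-Analysis.Analysis" "HOL-Library.Poly_Mapping" "HOL-Library.Multiset"
    "HOL-Library.Set_Algebras"
begin

text \<open>
  The ambient space \<open>\<real>\<^sup>n\<close> is an arbitrary type of class \<^class>\<open>euclidean_space\<close>, and \<open>\<int>\<^sup>n\<close> is the set
  of points with integer coordinates in its standard basis. On a product type this basis is the
  union of the two standard bases, so the lattice of the product is the product lattice.
\<close>

definition integer_lattice :: "'a::euclidean_space set" where
  "integer_lattice = {x. \<forall>b\<in>Basis. x \<bullet> b \<in> \<int>}"

definition lattice_polytope :: "'a::euclidean_space set \<Rightarrow> bool" where
  "lattice_polytope P \<longleftrightarrow> (\<exists>V. finite V \<and> V \<subseteq> integer_lattice \<and> P = convex hull V)"

definition lattice_points :: "'a::euclidean_space set \<Rightarrow> 'a set" where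
  "lattice_points P = P \<inter> integer_lattice"

text \<open>The sum is taken in the monoid of sets under Minkowski addition, so it is \<open>{0}\<close> for \<open>m = 0\<close>.\<close>

definition dilate :: "nat \<Rightarrow> 'a::euclidean_space set \<Rightarrow> 'a set" where
  "dilate m P = (\<Sum>i<m. P)"

text \<open>
  \<open>\<complex>[P]\<close> is a subset of the monoid algebra of \<open>\<nat> \<times> \<real>\<^sup>n\<close>: the pair \<open>(m, b)\<close> is the basis element
  given by the lattice point \<open>b\<close> of \<open>mP\<close>. The product is the convolution product of
  \<^type>\<open>poly_mapping\<close>.
\<close>

definition polytope_algebra :: "'a::euclidean_space set \<Rightarrow> (nat \<times> 'a \<Rightarrow>\<^sub>0 complex) set" where
  "polytope_algebra P =
     {f. \<forall>(m, b) \<in> Poly_Mapping.keys f. b \<in> lattice_points (dilate m P)}"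

inductive_set generated_algebra :: "('k::monoid_add \<Rightarrow>\<^sub>0 complex) set \<Rightarrow> ('k \<Rightarrow>\<^sub>0 complex) set"
  for G where
  scalar: "Poly_Mapping.single 0 c \<in> generated_algebra G"
| generator: "g \<in> G \<Longrightarrow> g \<in> generated_algebra G"
| add: "f \<in> generated_algebra G \<Longrightarrow> g \<in> generated_algebra G \<Longrightarrow> f + g \<in> generated_algebra G"
| mult: "f \<in> generated_algebra G \<Longrightarrow> g \<in> generated_algebra G \<Longrightarrow> f * g \<in> generated_algebra G"

definition normal_polytope :: "'a::euclidean_space set \<Rightarrow> bool" where
  "normal_polytope P \<longleftrightarrow>
     generated_algebra ((\<lambda>x. Poly_Mapping.single (1, x) 1) ` lattice_points P) = polytope_algebra P"

text \<open>
  A monomial of \<open>\<complex>[X\<^sub>P]\<close> is the multiset of its variables (the free commutative monoid on \<open>X\<^sub>P\<close>, with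
  multiset union as multiplication), and \<open>\<complex>[X\<^sub>P]\<close> is the monoid algebra of these multisets. The
  degree is the size and divisibility is \<open>\<subseteq>#\<close>.
\<close>

definition monomials :: "'a::euclidean_space set \<Rightarrow> 'a multiset set" where
  "monomials P = {u. set_mset u \<subseteq> lattice_points P}"

definition polynomials :: "'a::euclidean_space set \<Rightarrow> ('a multiset \<Rightarrow>\<^sub>0 complex) set" where
  "polynomials P = {f. Poly_Mapping.keys f \<subseteq> monomials P}"

definition to_polytope_algebra ::
    "('a::euclidean_space multiset \<Rightarrow>\<^sub>0 complex) \<Rightarrow> (nat \<times> 'a \<Rightarrow>\<^sub>0 complex)" where
  "to_polytope_algebra f =
     (\<Sum>u\<in>Poly_Mapping.keys f.
        Poly_Mapping.single (size u, sum_mset u) (Poly_Mapping.lookup f u))"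

definition polytope_ideal :: "'a::euclidean_space set \<Rightarrow> ('a multiset \<Rightarrow>\<^sub>0 complex) set" where
  "polytope_ideal P = {f \<in> polynomials P. to_polytope_algebra f = 0}"

text \<open>
  A term order on \<open>P\<close> is represented by a total function \<open>\<sigma>\<close>; only its values on the lattice points
  of \<open>P\<close> matter, since all monomials considered below lie in \<^term>\<open>monomials P\<close>.
\<close>

definition weight :: "('a \<Rightarrow> real) \<Rightarrow> 'a multiset \<Rightarrow> real" where
  "weight \<sigma> u = (\<Sum>x\<in>#u. \<sigma> x)"

definition monomial_le :: "('a \<Rightarrow> real) \<Rightarrow> 'a multiset \<Rightarrow> 'a multiset \<Rightarrow> bool" where
  "monomial_le \<sigma> u v \<longleftrightarrow> size u < size v \<or> (size u = size v \<and> weight \<sigma> u \<le> weight \<sigma> v)"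

definition initial_form ::
    "('a \<Rightarrow> real) \<Rightarrow> ('a multiset \<Rightarrow>\<^sub>0 complex) \<Rightarrow> ('a multiset \<Rightarrow>\<^sub>0 complex)" where
  "initial_form \<sigma> f =
     (\<Sum>u | u \<in> Poly_Mapping.keys f \<and> (\<forall>v\<in>Poly_Mapping.keys f. monomial_le \<sigma> v u).
        Poly_Mapping.single u (Poly_Mapping.lookup f u))"

type_synonym 'a ordered_polytope = "'a set \<times> ('a \<Rightarrow> real)"

fun standard_monomial :: "'a::euclidean_space ordered_polytope \<Rightarrow> 'a multiset \<Rightarrow> bool" where
  "standard_monomial (P, \<sigma>) u \<longleftrightarrow>
     u \<in> monomials P \<and>
     \<not> (\<exists>f\<in>polytope_ideal P. initial_form \<sigma> f = Poly_Mapping.single u 1)"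

definition monomial_fiber :: "'a::euclidean_space set \<Rightarrow> nat \<Rightarrow> 'a \<Rightarrow> 'a multiset set" where
  "monomial_fiber P m b = {u \<in> monomials P. size u = m \<and> sum_mset u = b}"

fun unique_standard_monomials :: "'a::euclidean_space ordered_polytope \<Rightarrow> bool" where
  "unique_standard_monomials (P, \<sigma>) \<longleftrightarrow>
     (\<forall>m. \<forall>b\<in>lattice_points (dilate m P). monomial_fiber P m b \<noteq> {} \<longrightarrow>
        (\<exists>!u. is_arg_min (weight \<sigma>) (\<lambda>u. u \<in> monomial_fiber P m b) u))"

fun flag_polytope :: "'a::euclidean_space ordered_polytope \<Rightarrow> bool" where
  "flag_polytope (P, \<sigma>) \<longleftrightarrow>
     (\<forall>u\<in>monomials P. standard_monomial (P, \<sigma>) u \<longleftrightarrow>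
        (\<forall>v. v \<subseteq># u \<and> size v = 2 \<longrightarrow> standard_monomial (P, \<sigma>) v)) \<and>
     (\<forall>x\<in>lattice_points P. \<forall>n. standard_monomial (P, \<sigma>) (replicate_mset n x))"

fun normal_ordered_polytope :: "'a::euclidean_space ordered_polytope \<Rightarrow> bool" where
  "normal_ordered_polytope (P, \<sigma>) \<longleftrightarrow> normal_polytope P"

text \<open>
  Morphisms are restrictions of linear maps of the ambient spaces. Affine lattice maps are covered
  after placing polytopes at height one, i.e. replacing \<open>P\<close> by \<open>P \<times> {1}\<close>.
\<close>

fun morphism_of ::
    "('a::euclidean_space \<Rightarrow> 'b::euclidean_space) \<Rightarrow>
     'a ordered_polytope \<Rightarrow> 'b ordered_polytope \<Rightarrow> bool" where
  "morphism_of \<pi> (P, \<sigma>) (Q, \<tau>) \<longleftrightarrow>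
     lattice_polytope P \<and> lattice_polytope Q \<and>
     linear \<pi> \<and> \<pi> ` integer_lattice \<subseteq> integer_lattice \<and> \<pi> ` P \<subseteq> Q \<and>
     (\<forall>u. standard_monomial (P, \<sigma>) u \<longrightarrow> standard_monomial (Q, \<tau>) (image_mset \<pi> u))"

fun fiber_product ::
    "('a::euclidean_space \<Rightarrow> 'c::euclidean_space) \<Rightarrow> ('b::euclidean_space \<Rightarrow> 'c) \<Rightarrow>
     'a ordered_polytope \<Rightarrow> 'b ordered_polytope \<Rightarrow> ('a \<times> 'b) ordered_polytope" where
  "fiber_product \<pi>\<^sub>1 \<pi>\<^sub>2 (P\<^sub>1, \<sigma>\<^sub>1) (P\<^sub>2, \<sigma>\<^sub>2) =
     ({(x, y). x \<in> P\<^sub>1 \<and> y \<in> P\<^sub>2 \<and> \<pi>\<^sub>1 x = \<pi>\<^sub>2 y}, \<lambda>(u, v). \<sigma>\<^sub>1 u + \<sigma>\<^sub>2 v)"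

end

theory Submission
  imports Defs
begin

text \<open>
  Normality of \<open>P\<close> says that every lattice point of \<open>mP\<close> is a sum of \<open>m\<close> lattice points of \<open>P\<close>
  (\<open>normal_polytope_iff\<close>), and a monomial is standard exactly if it has the least weight among the
  monomials with its degree and its sum (\<open>standard_monomial_iff\<close>).

  Let \<open>(a, b)\<close> be a lattice point of \<open>m(P\<^sub>1 \<times>\<^sub>Q P\<^sub>2)\<close>. Then \<open>a\<close> and \<open>b\<close> are lattice points of \<open>mP\<^sub>1\<close> and
  \<open>mP\<^sub>2\<close> with the same image \<open>c\<close> in \<open>mQ\<close>. By normality, \<open>a\<close> is the sum of a monomial of degree \<open>m\<close>
  on \<open>P\<^sub>1\<close>; as there are finitely many such monomials, one of them, \<open>u\<^sub>1\<close>, is standard. Similarly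
  \<open>b\<close> is the sum of a standard monomial \<open>u\<^sub>2\<close> on \<open>P\<^sub>2\<close>. The morphisms take \<open>u\<^sub>1\<close> and \<open>u\<^sub>2\<close> to standard
  monomials over \<open>c\<close>, and there is only one of these, so the multisets \<open>\<pi>\<^sub>1 u\<^sub>1\<close> and \<open>\<pi>\<^sub>2 u\<^sub>2\<close> are
  equal. Hence the points of \<open>u\<^sub>1\<close> can be matched with those of \<open>u\<^sub>2\<close> so that matched points have the
  same image in \<open>Q\<close> (\<open>image_mset_eq_matching\<close>). The \<open>m\<close> matched pairs are lattice points of the fiber
  product, and their sum is \<open>(a, b)\<close>.
\<close>

section \<open>Lattice points and dilations\<close>

lemma zero_in_integer_lattice: "0 \<in> integer_lattice"
  by (simp add: integer_lattice_def)

lemma add_in_integer_lattice: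
  "x \<in> integer_lattice \<Longrightarrow> y \<in> integer_lattice \<Longrightarrow> x + y \<in> integer_lattice"
  by (auto simp: integer_lattice_def inner_add_left)

lemma Pair_in_integer_lattice_iff:
  "(x, y) \<in> integer_lattice \<longleftrightarrow> x \<in> integer_lattice \<and> y \<in> integer_lattice"
  by (simp add: integer_lattice_def Basis_prod_def ball_Un)

lemma finite_lattice_points:
  fixes P :: "'a::euclidean_space set"
  assumes "bounded P"
  shows "finite (lattice_points P)"
proof -
  obtain M where M: "norm x \<le> M" if "x \<in> P" for x
    using assms by (auto simp: bounded_iff)
  let ?Z = "{t \<in> \<int>. -M \<le> t \<and> t \<le> M}"
  have "lattice_points P
      \<subseteq> (\<lambda>c. \<Sum>b\<in>Basis. c b *\<^sub>R b) ` (PiE Basis (\<lambda>_. ?Z))"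
  proof
    fix x assume x: "x \<in> lattice_points P"
    have "\<bar>x \<bullet> b\<bar> \<le> M" if "b \<in> Basis" for b
      using x M[of x] Basis_le_norm[OF that, of x] by (auto simp: lattice_points_def)
    then have "restrict (\<lambda>b. x \<bullet> b) Basis \<in> PiE Basis (\<lambda>_. ?Z)"
      using x by (auto simp: lattice_points_def integer_lattice_def abs_le_iff minus_le_iff)
    moreover have "x = (\<Sum>b\<in>Basis. restrict (\<lambda>b. x \<bullet> b) Basis b *\<^sub>R b)"
      by (simp add: euclidean_representation)
    ultimately show "x \<in> (\<lambda>c. \<Sum>b\<in>Basis. c b *\<^sub>R b) ` (PiE Basis (\<lambda>_. ?Z))"
      by blast
  qed
  then show ?thesis
    by (rule finite_subset) (intro finite_imageI finite_PiE finite_Basis finite_int_segment)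
qed

lemma bounded_lattice_polytope: "lattice_polytope P \<Longrightarrow> bounded P"
  by (auto simp: lattice_polytope_def bounded_convex_hull finite_imp_bounded)

lemma dilate_0: "dilate 0 P = {0}"
  by (simp add: dilate_def)

lemma dilate_Suc: "dilate (Suc m) P = dilate m P + P"
  by (simp add: dilate_def)

lemma linear_image_dilate_subset:
  assumes "linear f" "f ` P \<subseteq> Q"
  shows "f ` dilate m P \<subseteq> dilate m Q"
proof (induction m)
  case 0
  then show ?case using assms(1) by (simp add: dilate_0 linear_0)
next
  case (Suc m)
  then show ?case
    using assms by (force simp: dilate_Suc set_plus_def linear_add)
qed

lemma dilate_subset_subspace:
  assumes "subspace S" "P \<subseteq> S"
  shows "dilate m P \<subseteq> S"
proof (induction m)
  case 0
  then show ?case using assms(1) by (simp add: dilate_0 subspace_0)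
next
  case (Suc m)
  then show ?case
    using assms by (auto simp: dilate_Suc set_plus_def intro!: subspace_add)
qed

lemma sum_mset_in_lattice_points_dilate:
  assumes "u \<in> monomials P"
  shows "sum_mset u \<in> lattice_points (dilate (size u) P)"
  using assms
proof (induction u)
  case empty
  then show ?case by (simp add: lattice_points_def dilate_0 zero_in_integer_lattice)
next
  case (add x u)
  then have "x \<in> P" "x \<in> integer_lattice" "sum_mset u \<in> dilate (size u) P"
    "sum_mset u \<in> integer_lattice"
    by (auto simp: monomials_def lattice_points_def)
  then show ?case
    by (simp add: lattice_points_def dilate_Suc add.commute[of x] set_plus_intro add_in_integer_lattice)
qed

section \<open>Normality in terms of lattice points\<close>

text \<open>
  The pairs (degree, sum) of monomials form a submonoid that contains the exponents of the
  generators, so no product of generators can have an exponent outside it.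
\<close>

lemma keys_generated_algebra:
  fixes P :: "'a::euclidean_space set"
  assumes "f \<in> generated_algebra ((\<lambda>x. Poly_Mapping.single (1, x) 1) ` lattice_points P)"
    and "k \<in> Poly_Mapping.keys f"
  shows "\<exists>u\<in>monomials P. k = (size u, sum_mset u)"
  using assms
proof (induction f arbitrary: k)
  case (scalar c)
  then have "k = (size {#}, sum_mset {#})" by (simp add: zero_prod_def split: if_splits)
  then show ?case by (intro bexI[of _ "{#}"]) (simp_all add: monomials_def)
next
  case (generator g)
  then obtain x where "x \<in> lattice_points P" "k = (1, x)" by (auto split: if_splits)
  then show ?case by (intro bexI[of _ "{#x#}"]) (simp_all add: monomials_def)
next
  case (add f g)
  then show ?case using Poly_Mapping.keys_add[of f g] by blast
next
  case (mult f g)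
  then obtain k1 k2 where k: "k1 \<in> Poly_Mapping.keys f" "k2 \<in> Poly_Mapping.keys g" "k = k1 + k2"
    using Poly_Mapping.keys_mult[of f g] by blast
  obtain u v where "u \<in> monomials P" "k1 = (size u, sum_mset u)"
    "v \<in> monomials P" "k2 = (size v, sum_mset v)"
    using mult.IH(1)[OF k(1)] mult.IH(2)[OF k(2)] by blast
  with k(3) show ?case by (intro bexI[of _ "u + v"]) (auto simp: monomials_def)
qed

lemma single_in_generated_algebra:
  fixes P :: "'a::euclidean_space set"
  assumes "u \<in> monomials P"
  shows "Poly_Mapping.single (size u, sum_mset u) c
    \<in> generated_algebra ((\<lambda>x. Poly_Mapping.single (1, x) 1) ` lattice_points P)"
  using assms
proof (induction u)
  case empty
  then show ?case
    by (simp add: generated_algebra.scalar flip: zero_prod_def)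
next
  case (add x u)
  then have "x \<in> lattice_points P"
    and IH: "Poly_Mapping.single (size u, sum_mset u) c
      \<in> generated_algebra ((\<lambda>x. Poly_Mapping.single (1, x) 1) ` lattice_points P)"
    by (auto simp: monomials_def)
  then have "Poly_Mapping.single (1, x) 1 * Poly_Mapping.single (size u, sum_mset u) c
      \<in> generated_algebra ((\<lambda>x. Poly_Mapping.single (1, x) 1) ` lattice_points P)"
    by (intro generated_algebra.mult[OF generated_algebra.generator]) auto
  then show ?case by (simp add: mult_single)
qed

lemma sum_in_generated_algebra:
  "finite A \<Longrightarrow> (\<And>a. a \<in> A \<Longrightarrow> f a \<in> generated_algebra G)
    \<Longrightarrow> (\<Sum>a\<in>A. f a) \<in> generated_algebra G"
proof (induction A rule: finite_induct)
  case empty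
  then show ?case using generated_algebra.scalar[of 0] by simp
next
  case (insert a A)
  then show ?case by (simp add: generated_algebra.add)
qed

lemma sum_single_lookup:
  "(\<Sum>k\<in>Poly_Mapping.keys f. Poly_Mapping.single k (Poly_Mapping.lookup f k)) = f"
  by (rule poly_mapping_eqI) (simp add: lookup_sum lookup_single when_def sum.delta in_keys_iff)

lemma normal_polytope_iff:
  "normal_polytope P \<longleftrightarrow>
    (\<forall>m. \<forall>b\<in>lattice_points (dilate m P). monomial_fiber P m b \<noteq> {})"
  (is "?normal \<longleftrightarrow> ?covered")
proof
  assume ?normal
  show ?covered
  proof (intro allI ballI)
    fix m b assume "b \<in> lattice_points (dilate m P)"
    then have "Poly_Mapping.single (m, b) 1 \<in> polytope_algebra P"
      by (simp add: polytope_algebra_def)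
    with \<open>?normal\<close> have "Poly_Mapping.single (m, b) 1
        \<in> generated_algebra ((\<lambda>x. Poly_Mapping.single (1, x) 1) ` lattice_points P)"
      by (simp add: normal_polytope_def)
    from keys_generated_algebra[OF this, of "(m, b)"] show "monomial_fiber P m b \<noteq> {}"
      by (auto simp: monomial_fiber_def)
  qed
next
  assume ?covered
  let ?A = "generated_algebra ((\<lambda>x. Poly_Mapping.single (1, x) 1) ` lattice_points P)"
  have "f \<in> polytope_algebra P" if "f \<in> ?A" for f
    using keys_generated_algebra[OF that] sum_mset_in_lattice_points_dilate
    by (fastforce simp: polytope_algebra_def)
  moreover have "f \<in> ?A" if f: "f \<in> polytope_algebra P" for f
  proof -
    have "Poly_Mapping.single k (Poly_Mapping.lookup f k) \<in> ?A"
      if k: "k \<in> Poly_Mapping.keys f" for k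
    proof -
      have "snd k \<in> lattice_points (dilate (fst k) P)"
        using f k by (auto simp: polytope_algebra_def)
      then obtain u where "u \<in> monomials P" "k = (size u, sum_mset u)"
        using \<open>?covered\<close> by (cases k) (fastforce simp: monomial_fiber_def)
      then show ?thesis using single_in_generated_algebra by blast
    qed
    then have "(\<Sum>k\<in>Poly_Mapping.keys f. Poly_Mapping.single k (Poly_Mapping.lookup f k)) \<in> ?A"
      by (intro sum_in_generated_algebra) auto
    then show ?thesis by (simp add: sum_single_lookup)
  qed
  ultimately show ?normal by (auto simp: normal_polytope_def)
qed

section \<open>Standard monomials as monomials of least weight\<close>

lemma lookup_initial_form:
  "Poly_Mapping.lookup (initial_form \<sigma> f) v =
    (if v \<in> Poly_Mapping.keys f \<and> (\<forall>w\<in>Poly_Mapping.keys f. monomial_le \<sigma> w v)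
     then Poly_Mapping.lookup f v else 0)"
proof -
  let ?M = "{u \<in> Poly_Mapping.keys f. \<forall>w\<in>Poly_Mapping.keys f. monomial_le \<sigma> w u}"
  have "Poly_Mapping.lookup (initial_form \<sigma> f) v
      = (\<Sum>u\<in>?M. if u = v then Poly_Mapping.lookup f u else 0)"
    by (simp add: initial_form_def lookup_sum lookup_single when_def)
  also have "\<dots> = (if v \<in> ?M then Poly_Mapping.lookup f v else 0)"
    by (simp add: sum.delta)
  finally show ?thesis by simp
qed

text \<open>
  If \<open>v\<close> has the degree and the sum of \<open>u\<close> but smaller weight, the binomial \<open>u - v\<close> lies in the
  ideal and has initial form \<open>u\<close>. Conversely, suppose that \<open>u\<close> is the initial form of \<open>f\<close> in the
  ideal. The coefficient of \<open>u\<close> must cancel in the polytope algebra, so \<open>f\<close> has another term with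
  the degree and the sum of \<open>u\<close>; were \<open>u\<close> of least weight, this term would be as large as \<open>u\<close> and
  hence also belong to the initial form.
\<close>

lemma standard_monomial_iff:
  "standard_monomial (P, \<sigma>) u \<longleftrightarrow>
    is_arg_min (weight \<sigma>) (\<lambda>v. v \<in> monomial_fiber P (size u) (sum_mset u)) u"
proof (cases "u \<in> monomials P")
  case False
  then show ?thesis by (auto simp: is_arg_min_def monomial_fiber_def)
next
  case u: True
  have "\<exists>f\<in>polytope_ideal P. initial_form \<sigma> f = Poly_Mapping.single u 1"
    if v: "v \<in> monomial_fiber P (size u) (sum_mset u)" "weight \<sigma> v < weight \<sigma> u" for v
  proof
    define f :: "'a multiset \<Rightarrow>\<^sub>0 complex"
      where "f = Poly_Mapping.single u 1 - Poly_Mapping.single v 1"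
    have v': "v \<in> monomials P" "size v = size u" "sum_mset v = sum_mset u" "u \<noteq> v"
      using v by (auto simp: monomial_fiber_def)
    have lookup: "Poly_Mapping.lookup f w = (if w = u then 1 else if w = v then -1 else 0)" for w
      using \<open>u \<noteq> v\<close> by (auto simp: f_def lookup_minus lookup_single when_def)
    have keys: "Poly_Mapping.keys f = {u, v}"
      by (auto simp: in_keys_iff lookup split: if_splits)
    have "to_polytope_algebra f = 0"
      using v' by (simp add: to_polytope_algebra_def keys lookup flip: single_add)
    then show "f \<in> polytope_ideal P"
      using u v' by (simp add: polytope_ideal_def polynomials_def keys)
    show "initial_form \<sigma> f = Poly_Mapping.single u 1"
      using v v'
      by (intro poly_mapping_eqI)
        (auto simp: lookup_initial_form keys lookup lookup_single when_def monomial_le_def)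
  qed
  moreover have False
    if min: "\<And>v. v \<in> monomial_fiber P (size u) (sum_mset u) \<Longrightarrow> weight \<sigma> u \<le> weight \<sigma> v"
      and f: "f \<in> polytope_ideal P" and init: "initial_form \<sigma> f = Poly_Mapping.single u 1" for f
  proof -
    have lookup: "Poly_Mapping.lookup (initial_form \<sigma> f) v = (if v = u then 1 else 0)" for v
      by (auto simp: init lookup_single when_def)
    have fu: "u \<in> Poly_Mapping.keys f" "Poly_Mapping.lookup f u = 1"
      and top: "\<And>w. w \<in> Poly_Mapping.keys f \<Longrightarrow> monomial_le \<sigma> w u"
      using lookup[of u] by (auto simp: lookup_initial_form split: if_splits)
    have only_u: "v = u"
      if v: "v \<in> Poly_Mapping.keys f" "size v = size u" "sum_mset v = sum_mset u" for v
    proof (rule ccontr)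
      assume "v \<noteq> u"
      have "v \<in> monomial_fiber P (size u) (sum_mset u)"
        using v f by (auto simp: monomial_fiber_def polytope_ideal_def polynomials_def)
      then have "monomial_le \<sigma> w v" if "w \<in> Poly_Mapping.keys f" for w
        using min[of v] top[OF that] v(2) by (auto simp: monomial_le_def)
      then show False
        using lookup[of v] v(1) \<open>v \<noteq> u\<close> by (auto simp: lookup_initial_form in_keys_iff)
    qed
    have "Poly_Mapping.lookup (to_polytope_algebra f) (size u, sum_mset u)
        = (\<Sum>v\<in>Poly_Mapping.keys f. if v = u then Poly_Mapping.lookup f v else 0)"
      unfolding to_polytope_algebra_def lookup_sum
      by (intro sum.cong) (auto simp: lookup_single when_def dest: only_u)
    also have "\<dots> = 1" using fu by (simp add: sum.delta)
    finally show False using f by (simp add: polytope_ideal_def)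
  qed
  ultimately have "(\<exists>f\<in>polytope_ideal P. initial_form \<sigma> f = Poly_Mapping.single u 1) \<longleftrightarrow>
      (\<exists>v \<in> monomial_fiber P (size u) (sum_mset u). weight \<sigma> v < weight \<sigma> u)"
    by (meson not_le)
  with u show ?thesis by (auto simp: is_arg_min_def monomial_fiber_def)
qed

lemma finite_monomial_fiber:
  assumes "bounded P"
  shows "finite (monomial_fiber P m b)"
proof -
  have "monomial_fiber P m b \<subseteq> mset ` {xs. set xs \<subseteq> lattice_points P \<and> length xs = m}"
  proof
    fix u assume u: "u \<in> monomial_fiber P m b"
    obtain xs where "u = mset xs" by (metis ex_mset)
    with u show "u \<in> mset ` {xs. set xs \<subseteq> lattice_points P \<and> length xs = m}"
      by (auto simp: monomial_fiber_def monomials_def)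
  qed
  then show ?thesis
    by (rule finite_subset)
      (intro finite_imageI finite_lists_length_eq finite_lattice_points assms)
qed

lemma standard_monomial_exists:
  assumes "bounded P" "normal_polytope P" "b \<in> lattice_points (dilate m P)"
  obtains u where "standard_monomial (P, \<sigma>) u" "u \<in> monomial_fiber P m b"
proof -
  let ?F = "monomial_fiber P m b"
  have "finite ?F" "?F \<noteq> {}"
    using assms by (auto simp: finite_monomial_fiber normal_polytope_iff)
  then obtain u where "is_arg_min (weight \<sigma>) (\<lambda>v. v \<in> ?F) u"
    using ex_is_arg_min_if_finite by blast
  moreover from this have "u \<in> ?F" by (simp add: is_arg_min_def)
  moreover from this have "size u = m" "sum_mset u = b" by (auto simp: monomial_fiber_def)
  ultimately show thesis using that[of u] unfolding standard_monomial_iff by simp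
qed

lemma standard_monomials_eq:
  assumes "unique_standard_monomials (Q, \<sigma>)"
    and "standard_monomial (Q, \<sigma>) u" "standard_monomial (Q, \<sigma>) v"
    and "size u = size v" "sum_mset u = sum_mset v"
  shows "u = v"
proof -
  let ?F = "monomial_fiber Q (size v) (sum_mset v)"
  have min: "is_arg_min (weight \<sigma>) (\<lambda>w. w \<in> ?F) u" "is_arg_min (weight \<sigma>) (\<lambda>w. w \<in> ?F) v"
    using assms(2-5) by (simp_all only: standard_monomial_iff)
  have "v \<in> monomials Q" using assms(3) by simp
  then have "sum_mset v \<in> lattice_points (dilate (size v) Q)"
    by (rule sum_mset_in_lattice_points_dilate)
  moreover have "?F \<noteq> {}" using min by (auto simp: is_arg_min_def)
  ultimately have "\<exists>!w. is_arg_min (weight \<sigma>) (\<lambda>w. w \<in> ?F) w"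
    using assms(1) by simp
  with min show ?thesis by blast
qed

section \<open>Fiber products\<close>

text \<open>
  Equality of multisets is the relator of equality, and mapping inside a relator amounts to
  relating the arguments. A witness of the resulting relation is a multiset of pairs, which is the
  matching.
\<close>

lemma image_mset_eq_matching:
  assumes "image_mset f u = image_mset g v"
  obtains w where "image_mset fst w = u" "image_mset snd w = v"
    "\<And>x y. (x, y) \<in># w \<Longrightarrow> f x = g y"
proof -
  have "rel_mset (=) (image_mset f u) (image_mset g v)"
    using assms by (simp only: multiset.rel_eq)
  then have "rel_mset (\<lambda>x y. f x = g y) u v"
    by (simp only: multiset.rel_map)
  then show thesis
    using that by (fastforce simp: multiset.in_rel)
qed

lemma sum_mset_linear_image:
  "linear f \<Longrightarrow> sum_mset (image_mset f u) = f (sum_mset u)"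
  by (induction u) (simp_all add: linear_0 linear_add)

theorem proposition1p20:
  fixes P\<^sub>1 :: "'a::euclidean_space set" and \<sigma>\<^sub>1 :: "'a \<Rightarrow> real"
    and P\<^sub>2 :: "'b::euclidean_space set" and \<sigma>\<^sub>2 :: "'b \<Rightarrow> real"
    and Q :: "'c::euclidean_space set" and \<sigma> :: "'c \<Rightarrow> real"
    and \<pi>\<^sub>1 :: "'a \<Rightarrow> 'c" and \<pi>\<^sub>2 :: "'b \<Rightarrow> 'c"
  assumes "morphism_of \<pi>\<^sub>1 (P\<^sub>1, \<sigma>\<^sub>1) (Q, \<sigma>)"
    and "morphism_of \<pi>\<^sub>2 (P\<^sub>2, \<sigma>\<^sub>2) (Q, \<sigma>)"
    and "flag_polytope (P\<^sub>1, \<sigma>\<^sub>1)"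
    and "flag_polytope (P\<^sub>2, \<sigma>\<^sub>2)"
    and "unique_standard_monomials (Q, \<sigma>)"
    and "normal_ordered_polytope (P\<^sub>1, \<sigma>\<^sub>1)"
    and "normal_ordered_polytope (P\<^sub>2, \<sigma>\<^sub>2)"
  shows "normal_ordered_polytope (fiber_product \<pi>\<^sub>1 \<pi>\<^sub>2 (P\<^sub>1, \<sigma>\<^sub>1) (P\<^sub>2, \<sigma>\<^sub>2))"
proof -
  define F where "F = {(x, y). x \<in> P\<^sub>1 \<and> y \<in> P\<^sub>2 \<and> \<pi>\<^sub>1 x = \<pi>\<^sub>2 y}"
  have lin: "linear \<pi>\<^sub>1" "linear \<pi>\<^sub>2"
    and bdd: "bounded P\<^sub>1" "bounded P\<^sub>2"
    using assms(1,2) by (auto intro: bounded_lattice_polytope)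
  have "monomial_fiber F m p \<noteq> {}" if p: "p \<in> lattice_points (dilate m F)" for m p
  proof -
    obtain a b where ab: "p = (a, b)" by force
    have "fst ` F \<subseteq> P\<^sub>1" "snd ` F \<subseteq> P\<^sub>2" by (auto simp: F_def)
    then have "fst ` dilate m F \<subseteq> dilate m P\<^sub>1" "snd ` dilate m F \<subseteq> dilate m P\<^sub>2"
      by (simp_all add: linear_image_dilate_subset linear_fst linear_snd)
    then have a: "a \<in> lattice_points (dilate m P\<^sub>1)" and b: "b \<in> lattice_points (dilate m P\<^sub>2)"
      using p ab by (force simp: lattice_points_def Pair_in_integer_lattice_iff)+
    have "subspace {(x, y). \<pi>\<^sub>1 x = \<pi>\<^sub>2 y}"
      using lin by (auto simp: subspace_def linear_0 linear_add linear_scale zero_prod_def)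
    then have "dilate m F \<subseteq> {(x, y). \<pi>\<^sub>1 x = \<pi>\<^sub>2 y}"
      by (rule dilate_subset_subspace) (auto simp: F_def)
    then have eq: "\<pi>\<^sub>1 a = \<pi>\<^sub>2 b" using p ab by (auto simp: lattice_points_def)
    obtain u where u: "standard_monomial (P\<^sub>1, \<sigma>\<^sub>1) u" "u \<in> monomial_fiber P\<^sub>1 m a"
      using standard_monomial_exists[OF bdd(1) _ a] assms(6) by auto
    obtain v where v: "standard_monomial (P\<^sub>2, \<sigma>\<^sub>2) v" "v \<in> monomial_fiber P\<^sub>2 m b"
      using standard_monomial_exists[OF bdd(2) _ b] assms(7) by auto
    have "image_mset \<pi>\<^sub>1 u = image_mset \<pi>\<^sub>2 v"
    proof (rule standard_monomials_eq[OF assms(5)])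
      show "standard_monomial (Q, \<sigma>) (image_mset \<pi>\<^sub>1 u)"
        using assms(1) u(1) by (simp del: standard_monomial.simps)
      show "standard_monomial (Q, \<sigma>) (image_mset \<pi>\<^sub>2 v)"
        using assms(2) v(1) by (simp del: standard_monomial.simps)
      show "size (image_mset \<pi>\<^sub>1 u) = size (image_mset \<pi>\<^sub>2 v)"
        using u(2) v(2) by (simp add: monomial_fiber_def)
      show "sum_mset (image_mset \<pi>\<^sub>1 u) = sum_mset (image_mset \<pi>\<^sub>2 v)"
        using u(2) v(2) eq by (simp add: monomial_fiber_def sum_mset_linear_image lin)
    qed
    then obtain w where w: "image_mset fst w = u" "image_mset snd w = v"
      and match: "\<And>x y. (x, y) \<in># w \<Longrightarrow> \<pi>\<^sub>1 x = \<pi>\<^sub>2 y"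
      using image_mset_eq_matching[of \<pi>\<^sub>1 u \<pi>\<^sub>2 v] by blast
    have "w \<in> monomial_fiber F m p"
    proof -
      have "(x, y) \<in> lattice_points F" if xy: "(x, y) \<in># w" for x y
      proof -
        have "x \<in># u" "y \<in># v" using xy w by force+
        then show ?thesis
          using u(2) v(2) match[OF xy]
          by (auto simp: monomial_fiber_def monomials_def lattice_points_def F_def
              Pair_in_integer_lattice_iff)
      qed
      then have "w \<in> monomials F" by (auto simp: monomials_def)
      moreover have "size w = m" using w(1) u(2) by (auto simp: monomial_fiber_def)
      moreover have "fst (sum_mset w) = a" "snd (sum_mset w) = b"
        using w u(2) v(2)
        by (auto simp: monomial_fiber_def simp flip: sum_mset_linear_image[OF linear_fst]
            sum_mset_linear_image[OF linear_snd])
      ultimately show ?thesis by (simp add: monomial_fiber_def ab prod_eq_iff)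
    qed
    then show ?thesis by blast
  qed
  then have "normal_polytope F" by (simp add: normal_polytope_iff)
  then show ?thesis by (simp add: F_def)
qed

end
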